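(* Let $\bar y$ be the given linearization point, and let $N$ be the superposition operator of a polynomial of degree $p\in\mathbb N$ such that $N\in C(W,H)$. Let $\{\psi^1,\dots,\psi^n\}$, $\mathcal C=\operatorname{span}\{c_1,\dots,c_m\}$, $\beta^i$ and $\gamma^j$ be as introduced in the context. Let $d^{(2)}[\psi]$ solve the second simplified Newton step with the approximations $\Pi_\psi d^{(1)}$ and $y^{(1)}_\psi$ substituted for $d^{(1)}$ and $y^{(1)}$, that is, $$(\partial_t-A-C)d^{(2)}[\psi]=N(\bar y)-C\,\Pi_\psi d^{(1)}-N(y^{(1)}_\psi),\qquad d^{(2)}[\psi](0)=0.$$ Then for all $t\in[0,T]$ we have $d^{(2)}[\psi](t)=r(t)+b(t)+c(t)$ with $$r(t)=\int_0^tT(t-s)N(\bar y)\,ds,\qquad b(t)\in\overline{\operatorname{span}\Big\{\bigcup_{i=1}^n\beta^i([0,T])\Big\}}^{W},\qquad c(t)\in\overline{\operatorname{span}\Big\{\bigcup_{j=1}^m\gamma^j([0,T])\Big\}}^{W},$$ where $\beta^i([0,T])$ and $\gamma^j([0,T])$ denote the essential ranges of $\beta^i$ and $\gamma^j$.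
   Context: Setting: $T>0$; $V\hookrightarrow W\hookrightarrow H$ are Hilbert spaces (of functions on a spatial domain, so that superposition with a polynomial and pointwise products make sense) with dense embeddings; $y_0\in W$, $F\in H$, $U=L^2(0,T)$ (real-valued controls; $Fu$ denotes $t\mapsto u(t)F$). $Y,Z$ are Banach spaces with $Y\hookrightarrow L^2(0,T;V)\cap C([0,T],H)$ and $Z\hookrightarrow L^2(0,T;H)\times W$ (boundary conditions are included in the definition of $Y$). $A$ is an elliptic (linear) spatial operator, $N$ a nonlinear term of lower order, and the operator $E:Y\times U\to Z$, $E(y,u)=(\partial_t y-Ay+N(y)-Fu,\;y(0)-y_0)$, in which $u$ enters linearly, is continuously Fréchet differentiable with $E_y(y,u)\in\mathcal L(Y,Z)$ invertible for all $(y,u)\in Y\times U$. For every time-independent $\bar y\in Y$ the operator $A-N_y(\bar y)$ generates a strongly continuous semigroup $(T(t))_{t\ge0}$ on $H$. A linearization point $\bar y\in Y$ of $E$, constant in time, $\bar y(t)=\bar y_0$ with $\bar y_0\in V$, is fixed, and $C:=-N_y(\bar y)$. Solutions of $(\partial_t-A-C)z=f$, $z(0)=z_0$ are represented as mild solutions $z(t)=T(t)z_0+\int_0^tT(t-s)f(s)\,ds$. For a control $u\in U$, $d^{(1)}\in Y$ is the solution of the first Newton step $(\partial_t-A-C)d^{(1)}=A\bar y-N(\bar y)+Fu$, $d^{(1)}(0)=y_0-\bar y_0$, and $y^{(1)}:=\bar y+d^{(1)}$. The second simplified Newton step is $(\partial_t-A-C)d^{(2)}=N(\bar y)-Cd^{(1)}-N(y^{(1)})$,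 $d^{(2)}(0)=0$. Let $\{\psi^1,\dots,\psi^n\}\subset W$ be a given orthonormal subset of $W$. For $f\in L^2(0,T;W)$ put $\Pi_\psi f(t):=\sum_{i=1}^n(\psi^i,f(t))_W\psi^i$, and put $y^{(1)}_\psi:=\bar y+\Pi_\psi d^{(1)}$. $\mathcal C$ is the linear span of all products $\prod_{j=1}^{i}b_j$ with $1\le i\le p$ and $b_1,\dots,b_i\in\{\bar y,\psi^1,\dots,\psi^n\}$; it is required that $\mathcal C\subset H$, and $c_1,\dots,c_m$ are orthonormal vectors in $H$ with $\mathcal C=\operatorname{span}\{c_1,\dots,c_m\}$. $\beta^i$ ($1\le i\le n$) solves $(\partial_t-A-C)\beta^i=0$, $\beta^i(0)=-C\psi^i$, and $\gamma^j$ ($1\le j\le m$) solves $(\partial_t-A-C)\gamma^j=0$, $\gamma^j(0)=-c_j$. Essential range: for a function $f\in L^q(0,T;X)$, $X$ some Banach space, $f([0,T]):=\bigcap_{M\subset[0,T],\,\lambda(M)=0}\overline{\{f(t)\mid t\in[0,T]\setminus M\}}^{X}$, where $\lambda$ is Lebesgue measure. The notation $\overline{\,\cdot\,}^{W}$ denotes closure in $W$.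
   Formalization: The formal theorem additionally assumes that the constant term of the polynomial, viewed as a constant function, lies in 𝒞 (automatic if it is zero); without this the claim fails, e.g. for N(y)=y+1, ȳ=0 and ψ¹ an eigenfunction. *)

theory Defs
  imports "HOL-Analysis.Analysis" "HOL-Computational_Algebra.Polynomial"
begin

section \<open>Vector-valued Lebesgue spaces on an interval\<close>

text \<open>
  The Bochner integral of HOL-Analysis requires second countable target spaces.  In order not to
  restrict to separable Hilbert spaces, Bochner measurability is spelled out here, and integrals
  are written with the Henstock-Kurzweil \<open>integral\<close>, which is available for every normed space and
  agrees with the Bochner integral on Bochner integrable functions.
\<close>

definition strongly_measurable :: "'a measure \<Rightarrow> ('a \<Rightarrow> 'b::topological_space) \<Rightarrow> bool" where
  "strongly_measurable M f \<longleftrightarrow>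
     (\<exists>s :: nat \<Rightarrow> 'a \<Rightarrow> 'b. (\<forall>i. simple_function M (s i)) \<and>
        (AE x in M. (\<lambda>i. s i x) \<longlonglongrightarrow> f x))"

text \<open>\<open>Lq q T\<close> consists of the representatives of the elements of \<open>L\<^sup>q(0,T;X)\<close>, no quotient is taken.\<close>

definition Lq :: "nat \<Rightarrow> real \<Rightarrow> (real \<Rightarrow> 'b::real_normed_vector) set" where
  "Lq q T = {f. strongly_measurable (lebesgue_on {0..T}) f \<and>
                integrable (lebesgue_on {0..T}) (\<lambda>t. norm (f t) ^ q)}"

definition L2_norm :: "real \<Rightarrow> (real \<Rightarrow> 'b::real_normed_vector) \<Rightarrow> real" where
  "L2_norm T f = sqrt (\<integral>t. (norm (f t))\<^sup>2 \<partial>lebesgue_on {0..T})"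

text \<open>A bounded linear map into \<open>L\<^sup>2(0,T;X)\<close>, given by a choice of representatives.\<close>

definition bounded_linear_L2 ::
  "real \<Rightarrow> ('a::real_normed_vector \<Rightarrow> real \<Rightarrow> 'b::real_normed_vector) \<Rightarrow> bool" where
  "bounded_linear_L2 T e \<longleftrightarrow>
     (\<forall>y. e y \<in> Lq 2 T) \<and>
     (\<forall>x y. AE t in lebesgue_on {0..T}. e (x + y) t = e x t + e y t) \<and>
     (\<forall>a y. AE t in lebesgue_on {0..T}. e (a *\<^sub>R y) t = a *\<^sub>R e y t) \<and>
     (\<exists>K. \<forall>y. L2_norm T (e y) \<le> K * norm y)"

text \<open>The type \<open>'u\<close> is (isometrically, via \<open>e\<close>) the space \<open>L\<^sup>2(0,T)\<close>.\<close>

definition is_L2_space :: "real \<Rightarrow> ('u::real_normed_vector \<Rightarrow> real \<Rightarrow> real) \<Rightarrow> bool" where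
  "is_L2_space T e \<longleftrightarrow>
     bounded_linear_L2 T e \<and>
     (\<forall>u. norm u = L2_norm T (e u)) \<and>
     (\<forall>g \<in> Lq 2 T. \<exists>u. AE t in lebesgue_on {0..T}. e u t = g t)"

definition essential_range :: "real \<Rightarrow> (real \<Rightarrow> 'b::topological_space) \<Rightarrow> 'b set" where
  "essential_range T f =
     (\<Inter>E \<in> {E. E \<subseteq> {0..T} \<and> E \<in> null_sets lebesgue}. closure (f ` ({0..T} - E)))"


section \<open>Function spaces\<close>

definition dense_embedding ::
  "('a::real_normed_vector \<Rightarrow>\<^sub>L 'b::real_normed_vector) \<Rightarrow> bool" where
  "dense_embedding j \<longleftrightarrow> inj (blinfun_apply j) \<and> closure (range (blinfun_apply j)) = UNIV"

text \<open>
  \<open>rep\<close> exhibits \<open>'h\<close> as a space of measurable real functions on \<open>M\<close> (the spatial domain with its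
  measure) modulo equality almost everywhere.
\<close>

definition function_space :: "'x measure \<Rightarrow> ('h::real_vector \<Rightarrow> 'x \<Rightarrow> real) \<Rightarrow> bool" where
  "function_space M rep \<longleftrightarrow>
     (\<forall>h. rep h \<in> borel_measurable M) \<and>
     (\<forall>g h. AE x in M. rep (g + h) x = rep g x + rep h x) \<and>
     (\<forall>a h. AE x in M. rep (a *\<^sub>R h) x = a * rep h x) \<and>
     (\<forall>h. (AE x in M. rep h x = 0) \<longrightarrow> h = 0)"

definition superposition_operator ::
  "'x measure \<Rightarrow> ('h::real_normed_vector \<Rightarrow> 'x \<Rightarrow> real) \<Rightarrow> ('w::real_normed_vector \<Rightarrow>\<^sub>L 'h) \<Rightarrow>
   real poly \<Rightarrow> ('w \<Rightarrow> 'h) \<Rightarrow> bool" where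
  "superposition_operator M rep j P N \<longleftrightarrow>
     (\<forall>w. AE x in M. rep (N w) x = poly P (rep (j w) x))"

definition is_product ::
  "'x measure \<Rightarrow> ('h \<Rightarrow> 'x \<Rightarrow> real) \<Rightarrow> nat \<Rightarrow> (nat \<Rightarrow> 'h) \<Rightarrow> 'h \<Rightarrow> bool" where
  "is_product M rep i b h \<longleftrightarrow> (AE x in M. rep h x = (\<Prod>j=1..i. rep (b j) x))"

text \<open>All products of between \<open>1\<close> and \<open>p\<close> factors from \<open>B\<close>, as elements of \<open>'h\<close>; the span of the
  products is contained in the function space iff each single product is.\<close>

definition products ::
  "'x measure \<Rightarrow> ('h \<Rightarrow> 'x \<Rightarrow> real) \<Rightarrow> nat \<Rightarrow> 'h set \<Rightarrow> 'h set" where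
  "products M rep p B =
     {h. \<exists>i\<in>{1..p}. \<exists>b. (\<forall>j\<in>{1..i}. b j \<in> B) \<and> is_product M rep i b h}"

definition products_in_space ::
  "'x measure \<Rightarrow> ('h \<Rightarrow> 'x \<Rightarrow> real) \<Rightarrow> nat \<Rightarrow> 'h set \<Rightarrow> bool" where
  "products_in_space M rep p B \<longleftrightarrow>
     (\<forall>i\<in>{1..p}. \<forall>b. (\<forall>j\<in>{1..i}. b j \<in> B) \<longrightarrow> (\<exists>h. is_product M rep i b h))"

definition orthonormal_family :: "nat \<Rightarrow> (nat \<Rightarrow> 'a::real_inner) \<Rightarrow> bool" where
  "orthonormal_family n e \<longleftrightarrow>
     (\<forall>i\<in>{1..n}. \<forall>k\<in>{1..n}. e i \<bullet> e k = (if i = k then 1 else 0))"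

definition proj_onto :: "nat \<Rightarrow> (nat \<Rightarrow> 'w::real_inner) \<Rightarrow> 'w \<Rightarrow> 'w" where
  "proj_onto n \<psi> w = (\<Sum>i=1..n. (\<psi> i \<bullet> w) *\<^sub>R \<psi> i)"


section \<open>Operators and semigroups\<close>

text \<open>Spatial operators map a subspace \<open>D\<close> of \<open>'v\<close> into \<open>'h\<close>; values outside \<open>D\<close> are irrelevant.\<close>

definition linear_operator ::
  "'v::real_vector set \<Rightarrow> ('v \<Rightarrow> 'h::real_vector) \<Rightarrow> bool" where
  "linear_operator D A \<longleftrightarrow>
     subspace D \<and>
     (\<forall>v\<in>D. \<forall>w\<in>D. A (v + w) = A v + A w) \<and>
     (\<forall>a. \<forall>v\<in>D. A (a *\<^sub>R v) = a *\<^sub>R A v)"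

definition C0_semigroup :: "(real \<Rightarrow> 'h::real_normed_vector \<Rightarrow>\<^sub>L 'h) \<Rightarrow> bool" where
  "C0_semigroup S \<longleftrightarrow>
     S 0 = id_blinfun \<and>
     (\<forall>s\<ge>0. \<forall>t\<ge>0. S (s + t) = S s o\<^sub>L S t) \<and>
     (\<forall>x. ((\<lambda>t. S t x) \<longlongrightarrow> x) (at_right 0))"

text \<open>The infinitesimal generator of \<open>S\<close>, domain included, is \<open>B\<close> on \<open>D\<close>, viewed in \<open>'h\<close> via \<open>j\<close>.\<close>

definition generates ::
  "('v::real_normed_vector \<Rightarrow>\<^sub>L 'h::real_normed_vector) \<Rightarrow> 'v set \<Rightarrow> ('v \<Rightarrow> 'h) \<Rightarrow>
   (real \<Rightarrow> 'h \<Rightarrow>\<^sub>L 'h) \<Rightarrow> bool" where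
  "generates j D B S \<longleftrightarrow>
     C0_semigroup S \<and>
     (\<forall>x g. ((\<lambda>h. (S h x - x) /\<^sub>R h) \<longlongrightarrow> g) (at_right 0) \<longleftrightarrow> (\<exists>v\<in>D. j v = x \<and> B v = g))"

text \<open>\<open>z\<close> is the mild solution of \<open>z' - G z = f\<close>, \<open>z(0) = z\<^sub>0\<close>, with \<open>S\<close> generated by \<open>G\<close> and
  right-hand side in \<open>L\<^sup>2(0,T;H)\<close>.\<close>

definition mild_solution ::
  "real \<Rightarrow> (real \<Rightarrow> 'h::real_normed_vector \<Rightarrow>\<^sub>L 'h) \<Rightarrow> (real \<Rightarrow> 'h) \<Rightarrow> 'h \<Rightarrow> (real \<Rightarrow> 'h) \<Rightarrow> bool" where
  "mild_solution T S f z0 z \<longleftrightarrow>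
     f \<in> Lq 2 T \<and>
     (\<forall>t\<in>{0..T}. z t = S t z0 + integral {0..t} (\<lambda>s. S (t - s) (f s)))"


section \<open>The state equation\<close>

text \<open>
  The continuous embedding of \<open>'y\<close> into \<open>L\<^sup>2(0,T;V) \<inter> C([0,T],H)\<close>: \<open>yV y\<close> and \<open>yH y\<close> are the same
  function of time, with values in \<open>V\<close> (for almost all times) and in \<open>H\<close> (for all times).
\<close>

definition state_space ::
  "real \<Rightarrow> ('v::real_normed_vector \<Rightarrow>\<^sub>L 'h::real_normed_vector) \<Rightarrow>
   ('y::real_normed_vector \<Rightarrow> real \<Rightarrow> 'v) \<Rightarrow> ('y \<Rightarrow> real \<Rightarrow> 'h) \<Rightarrow> bool" where
  "state_space T jVH yV yH \<longleftrightarrow>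
     bounded_linear_L2 T yV \<and>
     (\<forall>y. continuous_on {0..T} (yH y)) \<and>
     (\<forall>t\<in>{0..T}. linear (\<lambda>y. yH y t)) \<and>
     (\<exists>K. \<forall>y. \<forall>t\<in>{0..T}. norm (yH y t) \<le> K * norm y) \<and>
     (\<forall>y. AE t in lebesgue_on {0..T}. jVH (yV y t) = yH y t) \<and>
     (\<forall>y. (\<forall>t\<in>{0..T}. yH y t = 0) \<longrightarrow> y = 0)"

text \<open>The continuous embedding \<open>z \<mapsto> (zH z, zW z)\<close> of \<open>'z\<close> into \<open>L\<^sup>2(0,T;H) \<times> W\<close>.\<close>

definition data_space ::
  "real \<Rightarrow> ('z::real_normed_vector \<Rightarrow> real \<Rightarrow> 'h::real_normed_vector) \<Rightarrow>
   ('z \<Rightarrow>\<^sub>L 'w::real_normed_vector) \<Rightarrow> bool" where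
  "data_space T zH zW \<longleftrightarrow>
     bounded_linear_L2 T zH \<and>
     (\<forall>z. (AE t in lebesgue_on {0..T}. zH z t = 0) \<and> zW z = 0 \<longrightarrow> z = 0)"

text \<open>
  \<open>y' - A y = f\<close> on \<open>(0,T)\<close> for continuous \<open>y\<close>, in the time-integrated form that does not
  require \<open>y'\<close> and \<open>A y\<close> to be \<open>H\<close>-valued separately.
\<close>

definition evolution_equation ::
  "real \<Rightarrow> ('v::real_normed_vector \<Rightarrow>\<^sub>L 'h::real_normed_vector) \<Rightarrow> 'v set \<Rightarrow> ('v \<Rightarrow> 'h) \<Rightarrow>
   (real \<Rightarrow> 'h) \<Rightarrow> (real \<Rightarrow> 'h) \<Rightarrow> bool" where
  "evolution_equation T jVH D A y f \<longleftrightarrow>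
     f \<in> Lq 1 T \<and>
     (\<forall>t\<in>{0..T}. \<exists>v\<in>D. jVH v = integral {0..t} y \<and> y t = y 0 + A v + integral {0..t} f)"

text \<open>
  \<open>E(y,u) = (y' - A y + N(y) - F u, y(0) - y\<^sub>0)\<close>: the first component \<open>g = zH (E (y, u))\<close> is
  characterised by \<open>y' - A y = g - N(y) + F u\<close>.
\<close>

definition state_operator ::
  "real \<Rightarrow> ('v::real_normed_vector \<Rightarrow>\<^sub>L 'w::real_normed_vector) \<Rightarrow>
   ('w \<Rightarrow>\<^sub>L 'h::real_normed_vector) \<Rightarrow>
   ('y \<Rightarrow> real \<Rightarrow> 'v) \<Rightarrow> ('y \<Rightarrow> real \<Rightarrow> 'h) \<Rightarrow> ('u \<Rightarrow> real \<Rightarrow> real) \<Rightarrow>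
   ('z::real_normed_vector \<Rightarrow> real \<Rightarrow> 'h) \<Rightarrow> ('z \<Rightarrow>\<^sub>L 'w) \<Rightarrow>
   'v set \<Rightarrow> ('v \<Rightarrow> 'h) \<Rightarrow> ('w \<Rightarrow> 'h) \<Rightarrow> 'h \<Rightarrow> 'w \<Rightarrow> ('y \<times> 'u \<Rightarrow> 'z) \<Rightarrow> bool" where
  "state_operator T jVW jWH yV yH uR zH zW D A N F y0 E \<longleftrightarrow>
     (\<forall>y u.
        evolution_equation T (jWH o\<^sub>L jVW) D A (yH y)
          (\<lambda>t. zH (E (y, u)) t - N (jVW (yV y t)) + uR u t *\<^sub>R F) \<and>
        jWH (zW (E (y, u))) = yH y 0 - jWH y0)"

text \<open>Continuously Frechet differentiable, with boundedly invertible partial derivative \<open>E\<^sub>y\<close>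
  everywhere.\<close>

definition C1_with_invertible_partial ::
  "('y::real_normed_vector \<times> 'u::real_normed_vector \<Rightarrow> 'z::real_normed_vector) \<Rightarrow> bool" where
  "C1_with_invertible_partial E \<longleftrightarrow>
     (\<exists>E' :: 'y \<times> 'u \<Rightarrow> ('y \<times> 'u) \<Rightarrow>\<^sub>L 'z.
        (\<forall>q. (E has_derivative blinfun_apply (E' q)) (at q)) \<and>
        continuous_on UNIV E' \<and>
        (\<forall>q. \<exists>G :: 'z \<Rightarrow>\<^sub>L 'y. (\<forall>h. G (E' q (h, 0)) = h) \<and> (\<forall>z. E' q (G z, 0) = z)))"

end

theory Submission
  imports Defs
begin

text \<open>
  The right-hand side of the second Newton step is
  \<open>f(s) = N(ybar) - C \<Pi> d\<^sub>1(s) - N(ybar + \<Pi> d\<^sub>1(s))\<close>, where \<open>\<Pi>\<close> is the projection onto the span of the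
  \<open>\<psi>\<^sup>i\<close>.  For fixed \<open>s\<close> the last two terms live in fixed finite-dimensional spaces.  With
  \<open>a\<^sub>i(s) = (\<psi>\<^sup>i, d\<^sub>1(s))\<close> the second term is \<open>- (\<Sum>i. a\<^sub>i(s) C \<psi>\<^sup>i)\<close>.  The point \<open>ybar + \<Pi> d\<^sub>1(s)\<close> is a
  linear combination of \<open>ybar, \<psi>\<^sup>1, \<dots>, \<psi>\<^sup>n\<close>, and a polynomial of degree \<open>p\<close> in such a combination
  expands into products of at most \<open>p\<close> of these functions, plus a constant that belongs to the span
  of the \<open>c\<^sub>j\<close> by hypothesis; so the third term is
  \<open>- (\<Sum>j. g\<^sub>j(s) c\<^sub>j)\<close> with \<open>g\<^sub>j(s) = (c\<^sub>j, N(ybar + \<Pi> d\<^sub>1(s)))\<close>.  This is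
  \<open>superposition_in_span_products\<close>, a multilinearity argument.

  Inserting this into the mild solution formula, and recognising \<open>S(t) (- C \<psi>\<^sup>i)\<close> as \<open>\<beta>\<^sup>i(t)\<close> and
  \<open>S(t) (- c\<^sub>j)\<close> as \<open>\<gamma>\<^sup>j(t)\<close>, gives \<open>d\<^sub>2 = r + b + c\<close> with
  \<open>b(t) = (\<Sum>i. \<integral>\<^sub>0\<^sup>t a\<^sub>i(s) \<beta>\<^sup>i(t-s) ds)\<close> and \<open>c(t) = (\<Sum>j. \<integral>\<^sub>0\<^sup>t g\<^sub>j(s) \<gamma>\<^sup>j(t-s) ds)\<close>.  The coefficients
  and the orbits are square integrable, so these are integrals in \<open>W\<close> that exist for every \<open>t\<close>.
  An integral of a function with values in a closed subspace lies in that subspace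
  (\<open>has_integral_in_closed_subspace\<close>), and a strongly measurable function takes almost all of its values
  in its essential range (\<open>AE_in_essential_range\<close>).  Hence \<open>b(t)\<close> and \<open>c(t)\<close> lie in the closed spans of
  the essential ranges; \<open>convolution_with_orbit\<close> combines these facts.

  The spaces need not be separable, so the integrals in \<open>W\<close> are Henstock-Kurzweil integrals; their
  existence for strongly measurable functions with integrable norm is \<open>Lq1_integrable_on\<close>.  The same
  convolution argument settles the integrability of \<open>s \<mapsto> S(t-s) N(ybar)\<close>, since \<open>N(ybar)\<close> is itself a
  combination of the \<open>c\<^sub>j\<close>.
\<close>

section \<open>Strongly measurable and square integrable functions\<close>

lemma strongly_measurable_compose2:
  fixes h :: "'b::topological_space \<Rightarrow> 'c::topological_space \<Rightarrow> 'd::topological_space"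
  assumes f: "strongly_measurable M f" and g: "strongly_measurable M g"
    and h: "continuous_on UNIV (\<lambda>p. h (fst p) (snd p))"
  shows "strongly_measurable M (\<lambda>x. h (f x) (g x))"
proof -
  obtain s where s: "\<And>i::nat. simple_function M (s i)" "AE x in M. (\<lambda>i. s i x) \<longlonglongrightarrow> f x"
    using f unfolding strongly_measurable_def by blast
  obtain r where r: "\<And>i::nat. simple_function M (r i)" "AE x in M. (\<lambda>i. r i x) \<longlonglongrightarrow> g x"
    using g unfolding strongly_measurable_def by blast
  have "AE x in M. (\<lambda>i. h (s i x) (r i x)) \<longlonglongrightarrow> h (f x) (g x)"
    using s(2) r(2)
  proof eventually_elim
    case (elim x)
    show ?case
      using continuous_on_tendsto_compose[OF h tendsto_Pair[OF elim]] by simp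
  qed
  moreover have "simple_function M (\<lambda>x. h (s i x) (r i x))" for i
    using s(1) r(1) by (rule simple_function_compose2)
  ultimately show ?thesis
    unfolding strongly_measurable_def by (intro exI[of _ "\<lambda>i x. h (s i x) (r i x)"]) auto
qed

lemma strongly_measurable_compose:
  assumes "strongly_measurable M f" and "continuous_on UNIV h"
  shows "strongly_measurable M (\<lambda>x. h (f x))"
proof (rule strongly_measurable_compose2[OF assms(1,1), where h = "\<lambda>x _. h x"])
  show "continuous_on UNIV (\<lambda>p. h (fst p))"
    by (rule continuous_on_compose2[OF assms(2) continuous_on_fst[OF continuous_on_id]]) simp
qed

lemma strongly_measurable_const: "strongly_measurable M (\<lambda>x. k)"
  unfolding strongly_measurable_def by (intro exI[of _ "\<lambda>i x. k"]) auto

text \<open>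
  Simple functions are Borel measurable, and so is the limit of a sequence of real Borel functions;
  the convergence holds only almost everywhere, which is repaired by the completeness of Lebesgue
  measure.  Composed with the norm or with an inner product, this makes vector-valued strongly
  measurable functions accessible to real integration theory.
\<close>
lemma strongly_measurable_imp_borel:
  fixes f :: "'a::euclidean_space \<Rightarrow> real"
  assumes f: "strongly_measurable (lebesgue_on S) f" and S: "S \<in> sets lebesgue"
  shows "f \<in> borel_measurable (lebesgue_on S)"
proof -
  obtain s where s: "\<And>i::nat. simple_function (lebesgue_on S) (s i)"
      "AE x in lebesgue_on S. (\<lambda>i. s i x) \<longlonglongrightarrow> f x"
    using f unfolding strongly_measurable_def by blast
  define v where "v i x = (if x \<in> S then s i x else 0)" for i x
  have v [measurable]: "v i \<in> borel_measurable lebesgue" for i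
    unfolding v_def using borel_measurable_simple_function[OF s(1)] S
    by (intro borel_measurable_if_I) auto
  have "AE x in lebesgue. x \<in> S \<longrightarrow> (\<lambda>i. s i x) \<longlonglongrightarrow> f x"
    using s(2) S by (subst (asm) AE_restrict_space_iff) auto
  then have "AE x in lebesgue. lim (\<lambda>i. v i x) = (if x \<in> S then f x else 0)"
    by eventually_elim (auto simp: v_def limI)
  moreover have "(\<lambda>x. lim (\<lambda>i. v i x)) \<in> borel_measurable lebesgue"
    by measurable
  ultimately have "(\<lambda>x. if x \<in> S then f x else 0) \<in> borel_measurable lebesgue"
    by (rule borel_measurable_AE[rotated])
  then show ?thesis
    by (rule borel_measurable_if_D)
qed

lemma strongly_measurable_norm_borel:
  fixes f :: "'a::euclidean_space \<Rightarrow> 'b::real_normed_vector"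
  assumes "strongly_measurable (lebesgue_on S) f" and "S \<in> sets lebesgue"
  shows "(\<lambda>x. norm (f x)) \<in> borel_measurable (lebesgue_on S)"
  by (rule strongly_measurable_imp_borel[OF strongly_measurable_compose[OF assms(1)] assms(2)])
     (intro continuous_intros)

lemma integrable_const_interval: "integrable (lebesgue_on {a..b::real}) (\<lambda>x. k::real)"
  by (intro finite_measure.integrable_const finite_measure_lebesgue_on) auto

lemma LqI:
  fixes f :: "real \<Rightarrow> 'b::real_normed_vector"
  assumes f: "strongly_measurable (lebesgue_on {0..T}) f"
    and g: "integrable (lebesgue_on {0..T}) g" and le: "\<And>t. norm (f t) ^ q \<le> g t"
  shows "f \<in> Lq q T"
proof -
  have [measurable]: "(\<lambda>t. norm (f t)) \<in> borel_measurable (lebesgue_on {0..T})"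
    using f by (rule strongly_measurable_norm_borel) auto
  have "integrable (lebesgue_on {0..T}) (\<lambda>t. norm (f t) ^ q)"
    using g by (rule Bochner_Integration.integrable_bound)
      (auto intro!: AE_I2 order_trans[OF le])
  then show ?thesis using f by (simp add: Lq_def)
qed

lemma Lq_const: "(\<lambda>t. k) \<in> Lq q T"
  by (rule LqI[OF strongly_measurable_const integrable_const_interval order_refl])

lemma Lq_bounded_linear:
  assumes f: "f \<in> Lq q T" and L: "bounded_linear L"
  shows "(\<lambda>t. L (f t)) \<in> Lq q T"
proof -
  obtain K where K: "\<And>x. norm (L x) \<le> norm x * K" 
    using bounded_linear.bounded[OF L] by blast
  have "integrable (lebesgue_on {0..T}) (\<lambda>t. norm (f t) ^ q * \<bar>K\<bar> ^ q)"
    using f by (simp add: Lq_def)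
  then show ?thesis
  proof (rule LqI[rotated])
    show "strongly_measurable (lebesgue_on {0..T}) (\<lambda>t. L (f t))"
      using f L unfolding Lq_def
      by (intro strongly_measurable_compose[where h = L] linear_continuous_on) auto
    fix t
    have "norm (L (f t)) \<le> norm (f t) * \<bar>K\<bar>"
      by (rule order_trans[OF K]) (auto intro: mult_left_mono)
    then show "norm (L (f t)) ^ q \<le> norm (f t) ^ q * \<bar>K\<bar> ^ q"
      unfolding power_mult_distrib[symmetric] by (rule power_mono) simp
  qed
qed

lemma Lq2_diff:
  fixes f g :: "real \<Rightarrow> 'b::real_normed_vector"
  assumes f: "f \<in> Lq 2 T" and g: "g \<in> Lq 2 T"
  shows "(\<lambda>t. f t - g t) \<in> Lq 2 T"
proof (rule LqI)
  show "strongly_measurable (lebesgue_on {0..T}) (\<lambda>t. f t - g t)"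
    using f g unfolding Lq_def
    by (intro strongly_measurable_compose2[where h = "(-)"] continuous_intros) auto
  show "integrable (lebesgue_on {0..T}) (\<lambda>t. 2 * norm (f t) ^ 2 + 2 * norm (g t) ^ 2)"
    using f g by (auto simp: Lq_def)
  fix t
  have "norm (f t - g t) ^ 2 \<le> (norm (f t) + norm (g t)) ^ 2"
    by (intro power_mono norm_triangle_ineq4) auto
  also have "\<dots> \<le> 2 * norm (f t) ^ 2 + 2 * norm (g t) ^ 2"
    using sum_squares_bound[of "norm (f t)" "norm (g t)"] by (simp add: power2_sum)
  finally show "norm (f t - g t) ^ 2 \<le> 2 * norm (f t) ^ 2 + 2 * norm (g t) ^ 2" .
qed

text \<open>
  By \<open>2 \<bar>a\<bar> \<parallel>b\<parallel> \<le> \<bar>a\<bar>\<^sup>2 + \<parallel>b\<parallel>\<^sup>2\<close>.  This is what makes the convolution of an \<open>L\<^sup>2\<close> coefficient with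
  an \<open>L\<^sup>2\<close> orbit well defined at every single time.
\<close>
lemma Lq2_scaleR:
  fixes b :: "real \<Rightarrow> 'b::real_normed_vector"
  assumes a: "a \<in> Lq 2 T" and b: "b \<in> Lq 2 T"
  shows "(\<lambda>t. a t *\<^sub>R b t) \<in> Lq 1 T"
proof (rule LqI)
  show "strongly_measurable (lebesgue_on {0..T}) (\<lambda>t. a t *\<^sub>R b t)"
    using a b unfolding Lq_def
    by (intro strongly_measurable_compose2[where h = "(*\<^sub>R)"] continuous_intros) auto
  show "integrable (lebesgue_on {0..T}) (\<lambda>t. norm (a t) ^ 2 + norm (b t) ^ 2)"
    using a b by (auto simp: Lq_def)
  fix t
  have "2 * (norm (a t) * norm (b t)) \<le> norm (a t) ^ 2 + norm (b t) ^ 2"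
    using sum_squares_bound[of "norm (a t)" "norm (b t)"] by (simp only: mult.assoc)
  moreover have "0 \<le> norm (a t) * norm (b t)" by simp
  ultimately show "norm (a t *\<^sub>R b t) ^ 1 \<le> norm (a t) ^ 2 + norm (b t) ^ 2"
    unfolding norm_scaleR power_one_right real_norm_def by linarith
qed

lemma reflect_measurable: "(\<lambda>s. t - s) \<in> lebesgue \<rightarrow>\<^sub>M lebesgue" for t :: real
  using lebesgue_affine_measurable[of "\<lambda>_. -1" t] by simp

text \<open>
  Reflections preserve Lebesgue measure, hence its null sets; needed because a convolution
  evaluates its kernel at \<open>t - s\<close>.
\<close>
lemma AE_lebesgue_reflect:
  fixes t :: real
  assumes "AE s in lebesgue. Q s"
  shows "AE s in lebesgue. Q (t - s)"
proof -
  have eq: "density (distr lebesgue lebesgue (\<lambda>s. t - s)) (\<lambda>_. 1) = lebesgue"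
    using lebesgue_real_affine[of "-1" t] by simp
  have "AE s in density (distr lebesgue lebesgue (\<lambda>s. t - s)) (\<lambda>_. 1). Q s"
    unfolding eq by (rule assms)
  then have "AE s in distr lebesgue lebesgue (\<lambda>s. t - s). Q s"
    by (subst (asm) AE_density) auto
  then show ?thesis
    by (rule AE_distrD[OF reflect_measurable])
qed

lemma AE_interval_reflect:
  fixes t T :: real
  assumes "AE s in lebesgue_on {0..T}. Q s" and "t \<le> T"
  shows "AE s in lebesgue_on {0..t}. Q (t - s)"
proof -
  have "AE s in lebesgue. s \<in> {0..T} \<longrightarrow> Q s"
    using assms(1) by (subst (asm) AE_restrict_space_iff) auto
  from AE_lebesgue_reflect[OF this, of t] have "AE s in lebesgue. s \<in> {0..t} \<longrightarrow> Q (t - s)"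
    by eventually_elim (use assms(2) in auto)
  then show ?thesis
    by (subst AE_restrict_space_iff) auto
qed

lemma Lq_reflect:
  fixes f :: "real \<Rightarrow> 'b::real_normed_vector"
  assumes f: "f \<in> Lq q T" and t: "t \<le> T"
  shows "(\<lambda>s. f (t - s)) \<in> Lq q t"
proof -
  have refl: "(\<lambda>s. t - s) \<in> lebesgue_on {0..t} \<rightarrow>\<^sub>M lebesgue_on {0..T}"
    by (rule measurable_restrict_space3[OF reflect_measurable]) (use t in auto)
  obtain s where s: "\<And>i::nat. simple_function (lebesgue_on {0..T}) (s i)"
      "AE x in lebesgue_on {0..T}. (\<lambda>i. s i x) \<longlonglongrightarrow> f x"
    using f unfolding Lq_def strongly_measurable_def by blast
  have sm: "strongly_measurable (lebesgue_on {0..t}) (\<lambda>s. f (t - s))"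
    unfolding strongly_measurable_def
    by (intro exI[of _ "\<lambda>i x. s i (t - x)"] conjI allI simple_function_comp[OF refl s(1)]
        AE_interval_reflect[OF s(2) t])
  have "integrable (lebesgue_on {0..T}) (\<lambda>s. norm (f s) ^ q)"
    using f by (simp add: Lq_def)
  then have "integrable lebesgue (\<lambda>s. indicator {0..T} s * norm (f s) ^ q)"
    by (subst (asm) integrable_restrict_space) auto
  then have "integrable lebesgue (\<lambda>s. indicator {0..T} (t - s) * norm (f (t - s)) ^ q)"
    using lebesgue_integrable_real_affine_iff[of "-1" "\<lambda>s. indicator {0..T} s * norm (f s) ^ q" t] 
    by simp
  then have "integrable (lebesgue_on {0..t}) (\<lambda>s. indicator {0..T} (t - s) * norm (f (t - s)) ^ q)"
    by (rule integrable_restrict_space[THEN iffD2, rotated, OF integrable_mult_indicator[rotated]]) auto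
  then have "integrable (lebesgue_on {0..t}) (\<lambda>s. norm (f (t - s)) ^ q)"
    by (rule Bochner_Integration.integrable_cong[THEN iffD1, rotated -1])
       (use t in \<open>auto simp: indicator_def\<close>)
  then show ?thesis
    using sm by (simp add: Lq_def)
qed

text \<open>
  Reflecting twice on \<open>[0,t]\<close> is the identity, but after the first reflection only the values on
  \<open>[0,t]\<close> are left.
\<close>
lemma Lq_restrict:
  fixes f :: "real \<Rightarrow> 'b::real_normed_vector"
  assumes "f \<in> Lq q T" and "t \<le> T"
  shows "f \<in> Lq q t"
  using Lq_reflect[OF Lq_reflect[OF assms] order_refl] by simp

section \<open>Henstock-Kurzweil integrals of strongly measurable functions\<close>

lemma AE_interval_negligible:
  assumes "AE x in lebesgue_on {a..b::real}. Q x"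
  obtains Z where "negligible Z" "\<And>x. x \<in> {a..b} - Z \<Longrightarrow> Q x"
proof -
  have "AE x in lebesgue. x \<in> {a..b} \<longrightarrow> Q x"
    using assms by (subst (asm) AE_restrict_space_iff) auto
  then obtain Z where "negligible Z" "{x. \<not> (x \<in> {a..b} \<longrightarrow> Q x)} \<subseteq> Z"
    unfolding eventually_ae_filter_negligible by blast
  then show ?thesis using that by blast
qed

text \<open>
  After a modification on a null set all values lie in \<open>K\<close>; then so do all Riemann sums, and the
  integral is a limit of Riemann sums.
\<close>
lemma has_integral_in_closed_subspace:
  fixes f :: "real \<Rightarrow> 'b::real_normed_vector"
  assumes f: "(f has_integral w) {a..b}" and K: "subspace K" "closed K"
    and AE: "AE x in lebesgue_on {a..b}. f x \<in> K"
  shows "w \<in> K"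
proof -
  obtain Z where Z: "negligible Z" "\<And>x. x \<in> {a..b} - Z \<Longrightarrow> f x \<in> K"
    using AE_interval_negligible[OF AE] by blast
  define g where "g x = (if x \<in> {a..b} - Z then f x else 0)" for x
  have gK: "g x \<in> K" for x
    using Z(2) K(1) by (auto simp: g_def subspace_0)
  have "(g has_integral w) {a..b}"
    by (rule has_integral_spike[OF Z(1) _ f]) (simp add: g_def)
  then have lim: "((\<lambda>p. \<Sum>(x,k)\<in>p. Henstock_Kurzweil_Integration.content k *\<^sub>R g x) \<longlongrightarrow> w) (division_filter (cbox a b))"
    unfolding box_real[symmetric] has_integral_cbox .
  show ?thesis
  proof (rule Lim_in_closed_set[OF K(2) _ _ lim])
    show "\<forall>\<^sub>F p in division_filter (cbox a b). (\<Sum>(x,k)\<in>p. Henstock_Kurzweil_Integration.content k *\<^sub>R g x) \<in> K"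
      using gK K(1) by (intro always_eventually allI subspace_sum)
        (auto simp: split_beta intro: subspace_mul)
  qed (rule division_filter_not_empty)
qed

lemma simple_function_integrable_on:
  fixes s :: "real \<Rightarrow> 'b::real_normed_vector"
  assumes s: "simple_function (lebesgue_on {a..b}) s"
  shows "s integrable_on {a..b}"
proof -
  let ?A = "\<lambda>y. s -` {y} \<inter> {a..b}"
  have fin: "finite (s ` {a..b})"
    using simple_functionD(1)[OF s] by simp
  have "(\<lambda>x. \<Sum>y\<in>s ` {a..b}. indicat_real (?A y) x *\<^sub>R y) integrable_on {a..b}"
  proof (intro Henstock_Kurzweil_Integration.integrable_sum fin integrable_on_scaleR_left)
    fix y
    have "?A y \<in> sets (lebesgue_on {a..b})"
      using simple_functionD(2)[OF s, of "{y}"] by simp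
    then have "integrable (lebesgue_on {a..b}) (indicat_real (?A y))"
      by (intro finite_measure.integrable_const_bound[where B=1] finite_measure_lebesgue_on)
        (auto simp: indicator_def)
    then show "indicat_real (?A y) integrable_on {a..b}"
      by (rule integrable_on_lebesgue_on) auto
  qed
  then show ?thesis
  proof (rule integrable_eq)
    fix x assume x: "x \<in> {a..b}"
    have "(\<Sum>y\<in>s ` {a..b}. indicat_real (?A y) x *\<^sub>R y) = (\<Sum>y\<in>s ` {a..b}. if y = s x then y else 0)"
      using x by (intro sum.cong) (auto simp: indicator_def)
    then show "(\<Sum>y\<in>s ` {a..b}. indicat_real (?A y) x *\<^sub>R y) = s x"
      using x fin by simp
  qed
qed

text \<open>
  A gauge that is good for the integrals of both \<open>s\<close> and \<open>g\<close> makes the Riemann sums of \<open>f\<close> close to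
  the integral of \<open>s\<close>, because the Riemann sums of \<open>f - s\<close> are dominated by those of \<open>g\<close>.  So the
  Riemann sums of \<open>f\<close> satisfy the Cauchy criterion.
\<close>
lemma integrable_on_if_approximable:
  fixes f :: "real \<Rightarrow> 'b::{real_normed_vector, complete_space}"
  assumes approx: "\<And>e. e > 0 \<Longrightarrow> \<exists>s g I. s integrable_on {a..b} \<and> (g has_integral I) {a..b} \<and> I < e \<and>
      (\<forall>x\<in>{a..b}. norm (f x - s x) \<le> g x)"
  shows "f integrable_on {a..b}"
proof -
  have "f integrable_on cbox a b"
    unfolding integrable_Cauchy
  proof (intro allI impI)
    fix e :: real assume "e > 0"
    then have e: "e / 6 > 0" by simp
    obtain s g I where si: "s integrable_on {a..b}" and g: "(g has_integral I) {a..b}" and I: "I < e / 6"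
      and le: "\<And>x. x \<in> {a..b} \<Longrightarrow> norm (f x - s x) \<le> g x"
      using approx[OF e] by blast
    define Rs where "Rs h p = (\<Sum>(x,k)\<in>p. Henstock_Kurzweil_Integration.content k *\<^sub>R h x)" 
      for h :: "real \<Rightarrow> 'b" and p :: "(real \<times> real set) set"
    obtain d1 where d1: "gauge d1" "\<And>p. p tagged_division_of cbox a b \<Longrightarrow> d1 fine p \<Longrightarrow>
        norm (Rs s p - integral {a..b} s) < e / 6"
      using integrable_integral[OF si] e unfolding Rs_def box_real[symmetric] has_integral by meson
    obtain d2 where d2: "gauge d2" "\<And>p. p tagged_division_of cbox a b \<Longrightarrow> d2 fine p \<Longrightarrow>
        norm ((\<Sum>(x,k)\<in>p. Henstock_Kurzweil_Integration.content k *\<^sub>R g x) - I) < e / 6"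
      using g e unfolding box_real[symmetric] has_integral by meson
    have near: "norm (Rs f p - integral {a..b} s) < e / 2"
      if p: "p tagged_division_of cbox a b" "(\<lambda>x. d1 x \<inter> d2 x) fine p" for p
    proof -
      have fine: "d1 fine p" "d2 fine p" using p(2) by (auto simp: fine_Int)
      have "norm (Rs f p - Rs s p) = norm (\<Sum>(x,k)\<in>p. Henstock_Kurzweil_Integration.content k *\<^sub>R (f x - s x))"
        unfolding Rs_def by (simp add: sum_subtractf[symmetric] split_beta scaleR_diff_right)
      also have "\<dots> \<le> (\<Sum>(x,k)\<in>p. Henstock_Kurzweil_Integration.content k *\<^sub>R g x)"
      proof (rule sum_norm_le, clarify)
        fix x k assume "(x, k) \<in> p"
        then have "x \<in> {a..b}" using tagged_division_ofD(2,3)[OF p(1)] by fastforce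
        then show "norm (Henstock_Kurzweil_Integration.content k *\<^sub>R (f x - s x)) \<le> Henstock_Kurzweil_Integration.content k *\<^sub>R g x"
          using le by (simp add: mult_left_mono)
      qed
      also have "\<dots> < e / 6 + e / 6"
      proof -
        have "(\<Sum>(x,k)\<in>p. Henstock_Kurzweil_Integration.content k *\<^sub>R g x) - I < e / 6"
          using d2(2)[OF p(1) fine(2)] by (simp only: real_norm_def abs_less_iff)
        then show ?thesis using I by linarith
      qed
      finally have "norm (Rs f p - Rs s p) < e / 3" by simp
      then have "norm (Rs f p - Rs s p) + norm (Rs s p - integral {a..b} s) < e / 3 + e / 6"
        using d1(2)[OF p(1) fine(1)] by (rule add_strict_mono)
      then show ?thesis
        using norm_triangle_ineq[of "Rs f p - Rs s p" "Rs s p - integral {a..b} s"] by simp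
    qed
    show "\<exists>\<gamma>. gauge \<gamma> \<and> (\<forall>\<D>1 \<D>2. \<D>1 tagged_division_of (cbox a b) \<and> \<gamma> fine \<D>1 \<and>
            \<D>2 tagged_division_of (cbox a b) \<and> \<gamma> fine \<D>2 \<longrightarrow>
            norm ((\<Sum>(x,K)\<in>\<D>1. Henstock_Kurzweil_Integration.content K *\<^sub>R f x) - (\<Sum>(x,K)\<in>\<D>2. Henstock_Kurzweil_Integration.content K *\<^sub>R f x)) < e)"
    proof (intro exI[of _ "\<lambda>x. d1 x \<inter> d2 x"] conjI allI impI)
      show "gauge (\<lambda>x. d1 x \<inter> d2 x)" using d1(1) d2(1) by (rule gauge_Int)
      fix p q
      assume *: "p tagged_division_of cbox a b \<and> (\<lambda>x. d1 x \<inter> d2 x) fine p \<and>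
         q tagged_division_of cbox a b \<and> (\<lambda>x. d1 x \<inter> d2 x) fine q"
      have "norm (Rs f p - Rs f q) < e"
        by (rule norm_triangle_half_l[OF near near]) (use * in auto)
      then show "norm ((\<Sum>(x,K)\<in>p. Henstock_Kurzweil_Integration.content K *\<^sub>R f x) - (\<Sum>(x,K)\<in>q. Henstock_Kurzweil_Integration.content K *\<^sub>R f x)) < e"
        by (simp add: Rs_def)
    qed
  qed
  then show ?thesis by simp
qed

text \<open>
  Bochner integrable functions are Henstock-Kurzweil integrable: the simple functions approximating
  \<open>f\<close>, cut off where they exceed \<open>2 \<parallel>f\<parallel>\<close>, converge to \<open>f\<close> in the mean by dominated convergence.
\<close>
lemma Lq1_integrable_on:
  fixes f :: "real \<Rightarrow> 'b::{real_normed_vector, complete_space}"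
  assumes "f \<in> Lq 1 T"
  shows "f integrable_on {0..T}"
proof -
  let ?M = "lebesgue_on {0..T}"
  have sm: "strongly_measurable ?M f" and int: "integrable ?M (\<lambda>t. norm (f t))"
    using assms by (simp_all add: Lq_def)
  obtain s where s: "\<And>i::nat. simple_function ?M (s i)" "AE x in ?M. (\<lambda>i. s i x) \<longlonglongrightarrow> f x"
    using sm unfolding strongly_measurable_def by blast
  have nf [measurable]: "(\<lambda>t. norm (f t)) \<in> borel_measurable ?M"
    using int by simp
  \<comment> \<open>Any cut-off factor above \<open>1\<close> gives domination by \<open>f\<close> and leaves the pointwise limit unchanged.\<close>
  define r where "r i x = (if norm (s i x) \<le> 2 * norm (f x) then s i x else 0)" for i x
  have r: "simple_function ?M (r i)" for i
    unfolding r_def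
  proof (rule simple_function_If[OF s(1) simple_function_const])
    have [measurable]: "(\<lambda>x. norm (s i x)) \<in> borel_measurable ?M"
      by (rule borel_measurable_simple_function[OF simple_function_compose1[OF s(1)]])
    show "{x \<in> space ?M. norm (s i x) \<le> 2 * norm (f x)} \<in> sets ?M" by measurable
  qed
  have r_le: "norm (r i x) \<le> 2 * norm (f x)" for i x by (simp add: r_def)
  have r_lim: "AE x in ?M. (\<lambda>i. r i x) \<longlonglongrightarrow> f x"
    using s(2)
  proof eventually_elim
    case (elim x)
    show ?case
    proof (cases "f x = 0")
      case True
      then have "r i x = 0" for i by (simp add: r_def)
      then show ?thesis using True by simp
    next
      case False
      then have "norm (f x) < 2 * norm (f x)" by simp
      then have "\<forall>\<^sub>F i in sequentially. norm (s i x) < 2 * norm (f x)"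
        by (rule order_tendstoD(2)[OF tendsto_norm[OF elim]])
      then have "\<forall>\<^sub>F i in sequentially. s i x = r i x"
        by eventually_elim (simp add: r_def)
      then show ?thesis using elim by (rule Lim_transform_eventually[rotated])
    qed
  qed
  define g where "g i x = norm (f x - r i x)" for i x
  have g_meas: "g i \<in> borel_measurable ?M" for i
  proof -
    have "strongly_measurable ?M (r i)"
      unfolding strongly_measurable_def using r by (intro exI[of _ "\<lambda>_. r i"]) auto
    then have "strongly_measurable ?M (\<lambda>x. f x - r i x)"
      by (intro strongly_measurable_compose2[OF sm, where h = "(-)"] continuous_intros)
    then show ?thesis unfolding g_def by (rule strongly_measurable_norm_borel) auto
  qed
  have g_bound: "norm (g i x) \<le> 3 * norm (f x)" for i x
    using norm_triangle_ineq4[of "f x" "r i x"] r_le[of i x] by (simp add: g_def)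
  have g_lim: "AE x in ?M. (\<lambda>i. g i x) \<longlonglongrightarrow> 0"
    using r_lim
  proof eventually_elim
    case (elim x)
    show ?case
      unfolding g_def using tendsto_norm[OF tendsto_diff[OF tendsto_const elim, of "f x"]] by simp
  qed
  have g_int: "integrable ?M (g i)" for i
  proof (rule Bochner_Integration.integrable_bound[OF _ g_meas])
    show "integrable ?M (\<lambda>x. 3 * norm (f x))" using int by simp
  qed (use g_bound in auto)
  have lim0: "(\<lambda>i. integral\<^sup>L ?M (g i)) \<longlonglongrightarrow> integral\<^sup>L ?M (\<lambda>x. 0)"
    using g_lim g_bound int by (intro integral_dominated_convergence[where w="\<lambda>x. 3 * norm (f x)"] g_meas) auto
  show ?thesis
  proof (rule integrable_on_if_approximable)
    fix e :: real assume "e > 0"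
    then obtain i where i: "integral\<^sup>L ?M (g i) < e"
      using order_tendstoD(2)[OF lim0, of e] by (auto simp: eventually_sequentially)
    show "\<exists>s g I. s integrable_on {0..T} \<and> (g has_integral I) {0..T} \<and> I < e \<and>
      (\<forall>x\<in>{0..T}. norm (f x - s x) \<le> g x)"
      by (intro exI[of _ "r i"] exI[of _ "g i"] exI[of _ "integral\<^sup>L ?M (g i)"] conjI
          simple_function_integrable_on r has_integral_integral_lebesgue_on g_int i)
        (auto simp: g_def)
  qed
qed

text \<open>
  The values of the approximating simple functions form a countable set \<open>Q\<close>, and almost every value
  of \<open>f\<close> is a limit of elements of \<open>Q\<close>.  If such a value is outside the essential range, it has a
  neighbourhood with null preimage, and this neighbourhood can be taken to be a ball with centre in
  \<open>Q\<close> and rational radius.  There are only countably many such balls, so the union of their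
  preimages is still null.
\<close>
lemma AE_in_essential_range:
  fixes f :: "real \<Rightarrow> 'b::metric_space"
  assumes "strongly_measurable (lebesgue_on {0..T}) f"
  shows "AE t in lebesgue_on {0..T}. f t \<in> essential_range T f"
proof -
  let ?M = "lebesgue_on {0..T}"
  obtain s where s: "\<And>i::nat. simple_function ?M (s i)" "AE x in ?M. (\<lambda>i. s i x) \<longlonglongrightarrow> f x"
    using assms unfolding strongly_measurable_def by blast
  obtain Z where Z: "negligible Z" "\<And>x. x \<in> {0..T} - Z \<Longrightarrow> (\<lambda>i. s i x) \<longlonglongrightarrow> f x"
    using AE_interval_negligible[OF s(2)] by blast
  define Q where "Q = (\<Union>i. s i ` {0..T})"
  have "countable Q"
    unfolding Q_def using simple_functionD(1)[OF s(1)] by (auto intro: countable_finite)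
  define J where "J = {(q, d) \<in> Q \<times> \<rat>. negligible (f -` ball q d \<inter> {0..T})}"
  have "countable J"
    by (rule countable_subset[of _ "Q \<times> \<rat>"])
       (auto simp: J_def intro!: countable_SIGMA \<open>countable Q\<close> countable_rat)
  define B where "B = (\<Union>(q, d)\<in>J. f -` ball q d \<inter> {0..T})"
  have "negligible B"
    unfolding B_def
  proof (rule negligible_countable_Union)
    show "countable ((\<lambda>(q, d). f -` ball q d \<inter> {0..T}) ` J)" using \<open>countable J\<close> by simp
  qed (auto simp: J_def)
  then have null: "Z \<union> B \<in> null_sets lebesgue"
    using Z(1) by (simp add: negligible_iff_null_sets[symmetric])
  have main: "f t \<in> essential_range T f" if t: "t \<in> {0..T} - (Z \<union> B)" for t
  proof (rule ccontr)
    assume "f t \<notin> essential_range T f"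
    then obtain E where E: "E \<subseteq> {0..T}" "negligible E" "f t \<notin> closure (f ` ({0..T} - E))"
      by (auto simp: essential_range_def negligible_iff_null_sets)
    then obtain e where e: "e > 0" "\<And>x. x \<in> {0..T} - E \<Longrightarrow> \<not> dist (f x) (f t) < e"
      by (auto simp: closure_approachable)
    obtain d where d: "d \<in> \<rat>" "0 < d" "d < e / 2"
      using Rats_dense_in_real[of 0 "e / 2"] e(1) by auto
    have "(\<lambda>i. s i t) \<longlonglongrightarrow> f t" using Z(2) t by auto
    then obtain i where i: "dist (s i t) (f t) < d"
      using d(2) by (meson LIMSEQ_iff_nz lim_sequentially order_refl)
    have "f -` ball (s i t) d \<inter> {0..T} \<subseteq> E"
    proof
      fix x assume x: "x \<in> f -` ball (s i t) d \<inter> {0..T}"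
      then have "dist (f x) (f t) < e"
        using dist_triangle2[of "f x" "f t" "s i t"] i d(3) by (simp add: dist_commute)
      then show "x \<in> E" using e(2) x by auto
    qed
    then have "negligible (f -` ball (s i t) d \<inter> {0..T})"
      by (rule negligible_subset[OF E(2)])
    moreover have "s i t \<in> Q"
      unfolding Q_def using t by (intro UN_I[of i] imageI) auto
    ultimately have "(s i t, d) \<in> J"
      using d(1) by (simp add: J_def)
    moreover have "t \<in> f -` ball (s i t) d \<inter> {0..T}" using i t by auto
    ultimately have "t \<in> B"
      unfolding B_def by (intro UN_I[of "(s i t, d)"]) auto
    then show False using t by auto
  qed
  have "AE t in lebesgue. t \<notin> Z \<union> B" using null by (rule AE_not_in)
  then have "AE t in lebesgue. t \<in> {0..T} \<longrightarrow> f t \<in> essential_range T f"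
    by eventually_elim (use main in auto)
  then show ?thesis
    by (subst AE_restrict_space_iff) auto
qed

section \<open>Convolutions with semigroup orbits\<close>

text \<open>
  The convolution is formed in the smaller space \<open>W\<close>, where the orbit \<open>\<beta>\<close> is square integrable and
  takes almost all of its values in \<open>K\<close>; applying the embedding into \<open>H\<close> under the integral sign
  yields the mild-solution integral and shows along the way that its integrand is integrable.
\<close>
lemma convolution_with_orbit:
  fixes jWH :: "'w::{real_normed_vector, complete_space} \<Rightarrow>\<^sub>L 'h::real_normed_vector"
    and S :: "real \<Rightarrow> 'h \<Rightarrow>\<^sub>L 'h"
  assumes a: "a \<in> Lq 2 T" and \<beta>: "\<beta> \<in> Lq 2 T"
    and orbit: "AE t in lebesgue_on {0..T}. jWH (\<beta> t) = S t x"
    and t: "t \<le> T"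
    and K: "subspace K" "closed K" "essential_range T \<beta> \<subseteq> K"
  obtains w where "w \<in> K" "((\<lambda>s. a s *\<^sub>R S (t - s) x) has_integral jWH w) {0..t}"
proof -
  have "(\<lambda>s. a s *\<^sub>R \<beta> (t - s)) integrable_on {0..t}"
    by (intro Lq1_integrable_on Lq2_scaleR Lq_restrict[OF a t] Lq_reflect[OF \<beta> t])
  then obtain w where w: "((\<lambda>s. a s *\<^sub>R \<beta> (t - s)) has_integral w) {0..t}"
    by (auto simp: integrable_on_def)
  have "AE s in lebesgue_on {0..T}. \<beta> s \<in> K"
    using AE_in_essential_range[of T \<beta>] \<beta> K(3) by (auto simp: Lq_def)
  from AE_interval_reflect[OF this t] have "AE s in lebesgue_on {0..t}. a s *\<^sub>R \<beta> (t - s) \<in> K"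
    by eventually_elim (rule subspace_mul[OF K(1)])
  then have "w \<in> K" by (rule has_integral_in_closed_subspace[OF w K(1,2)])
  moreover have "((\<lambda>s. a s *\<^sub>R S (t - s) x) has_integral jWH w) {0..t}"
  proof -
    obtain Z where Z: "negligible Z" "\<And>s. s \<in> {0..t} - Z \<Longrightarrow> jWH (\<beta> (t - s)) = S (t - s) x"
      using AE_interval_negligible[OF AE_interval_reflect[OF orbit t]] by blast
    show ?thesis
      by (rule has_integral_spike[OF Z(1) _ has_integral_linear[OF w blinfun.bounded_linear_right]])
         (simp add: Z(2) blinfun.scaleR_right)
  qed
  ultimately show ?thesis using that by blast
qed

lemma subspace_closure_span: "subspace (closure (span X))"
  for X :: "'a::real_normed_vector set"
proof (rule subspaceI)
  show "0 \<in> closure (span X)"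
    using closure_subset span_zero by blast
next
  fix x y assume "x \<in> closure (span X)" "y \<in> closure (span X)"
  then obtain u v where uv: "\<And>n::nat. u n \<in> span X" "\<And>n::nat. v n \<in> span X" "u \<longlonglongrightarrow> x" "v \<longlonglongrightarrow> y"
    unfolding closure_sequential by blast
  then show "x + y \<in> closure (span X)"
    unfolding closure_sequential
    by (intro exI[of _ "\<lambda>n. u n + v n"] conjI allI tendsto_add span_add)
next
  fix r x assume "x \<in> closure (span X)"
  then obtain u where u: "\<And>n::nat. u n \<in> span X" "u \<longlonglongrightarrow> x"
    unfolding closure_sequential by blast
  then show "r *\<^sub>R x \<in> closure (span X)"
    unfolding closure_sequential
    by (intro exI[of _ "\<lambda>n. r *\<^sub>R u n"] conjI allI tendsto_scaleR tendsto_const span_mul)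
qed

text \<open>
  For coefficients \<open>a i\<close> in \<open>L\<^sup>2(0,T)\<close>, the forcing \<open>- (\<Sum>i. a i s *\<^sub>R x i)\<close> contributes to the mild
  solution a convolution of the \<open>a i\<close> with the orbits of the vectors \<open>- x i\<close>, and these orbits are
  the \<open>\<phi> i\<close>.  The minus signs match the initial values \<open>- C \<psi>\<^sup>i\<close> and \<open>- c\<^sub>j\<close> of \<open>\<beta>\<^sup>i\<close> and \<open>\<gamma>\<^sup>j\<close>.
\<close>
lemma sum_of_convolutions:
  fixes jWH :: "'w::{real_normed_vector, complete_space} \<Rightarrow>\<^sub>L 'h::real_normed_vector"
    and S :: "real \<Rightarrow> 'h \<Rightarrow>\<^sub>L 'h" and n :: nat
  assumes \<phi>: "\<And>i. i \<in> {1..n} \<Longrightarrow> \<phi> i \<in> Lq 2 T \<and>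
           (\<exists>z. mild_solution T S (\<lambda>t. 0) (- x i) z \<and>
                (AE t in lebesgue_on {0..T}. jWH (\<phi> i t) = z t))"
    and a: "\<And>i. i \<in> {1..n} \<Longrightarrow> a i \<in> Lq 2 T" and t: "t \<le> T"
  obtains w where "w \<in> closure (span (\<Union>i\<in>{1..n}. essential_range T (\<phi> i)))"
    "((\<lambda>s. - S (t - s) (\<Sum>i=1..n. a i s *\<^sub>R x i)) has_integral jWH w) {0..t}"
proof -
  let ?K = "closure (span (\<Union>i\<in>{1..n}. essential_range T (\<phi> i)))"
  have "\<exists>w\<in>?K. ((\<lambda>s. a i s *\<^sub>R S (t - s) (- x i)) has_integral jWH w) {0..t}" if i: "i \<in> {1..n}" for i
  proof -
    obtain z where z: "mild_solution T S (\<lambda>t. 0) (- x i) z" "AE t in lebesgue_on {0..T}. jWH (\<phi> i t) = z t"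
      using \<phi>[OF i] by blast
    have "AE t in lebesgue_on {0..T}. jWH (\<phi> i t) = S t (- x i)"
      by (rule lebesgue_on_mono[OF z(2)]) (use z(1) in \<open>simp add: mild_solution_def\<close>)
    moreover have "essential_range T (\<phi> i) \<subseteq> ?K"
      using i by (auto intro!: closure_subset[THEN subsetD] span_base)
    ultimately show ?thesis
      using convolution_with_orbit[of "a i" T "\<phi> i" jWH S "- x i" t ?K] a[OF i] \<phi>[OF i] t
        subspace_closure_span by blast
  qed
  then have "\<forall>i\<in>{1..n}. \<exists>w. w \<in> ?K \<and> ((\<lambda>s. a i s *\<^sub>R S (t - s) (- x i)) has_integral jWH w) {0..t}"
    by blast
  from bchoice[OF this] obtain w where w: "\<And>i. i \<in> {1..n} \<Longrightarrow> w i \<in> ?K"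
     "\<And>i. i \<in> {1..n} \<Longrightarrow> ((\<lambda>s. a i s *\<^sub>R S (t - s) (- x i)) has_integral jWH (w i)) {0..t}"
    by blast
  have "((\<lambda>s. \<Sum>i=1..n. a i s *\<^sub>R S (t - s) (- x i)) has_integral (\<Sum>i=1..n. jWH (w i))) {0..t}"
    by (intro has_integral_sum finite_atLeastAtMost w(2))
  moreover have "(\<Sum>i=1..n. a i s *\<^sub>R S (t - s) (- x i)) = - S (t - s) (\<Sum>i=1..n. a i s *\<^sub>R x i)" for s
    by (simp add: blinfun.sum_right blinfun.scaleR_right blinfun.minus_right sum_negf)
  ultimately have "((\<lambda>s. - S (t - s) (\<Sum>i=1..n. a i s *\<^sub>R x i)) has_integral jWH (\<Sum>i=1..n. w i)) {0..t}"
    by (simp add: blinfun.sum_right)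
  moreover have "(\<Sum>i=1..n. w i) \<in> ?K"
    using w(1) by (intro subspace_sum subspace_closure_span)
  ultimately show ?thesis using that by blast
qed

section \<open>Polynomials of elements of a span\<close>

lemma function_space_add:
  assumes "function_space M rep"
  shows "AE x in M. rep (g + h) x = rep g x + rep h x"
  using assms by (auto simp: function_space_def)

lemma function_space_scaleR:
  assumes "function_space M rep"
  shows "AE x in M. rep (a *\<^sub>R h) x = a * rep h x"
  using assms by (auto simp: function_space_def)

lemma function_space_zero:
  assumes "function_space M rep"
  shows "AE x in M. rep 0 x = 0"
  using function_space_scaleR[OF assms, of 0 0] by simp

lemma function_space_sum:
  assumes "function_space M rep" and "finite I"
  shows "AE x in M. rep (sum h I) x = (\<Sum>i\<in>I. rep (h i) x)"
  using assms(2)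
proof (induction rule: finite_induct)
  case empty
  show ?case using function_space_zero[OF assms(1)] by simp
next
  case (insert i I)
  show ?case
    using insert.IH function_space_add[OF assms(1), of "h i" "sum h I"]
    by eventually_elim (use insert.hyps in simp)
qed

lemma function_space_eqI:
  assumes fs: "function_space M rep" and eq: "AE x in M. rep g x = rep h x"
  shows "g = h"
proof -
  have "AE x in M. rep (g + (-1) *\<^sub>R h) x = 0"
    using function_space_add[OF fs, of g "(-1) *\<^sub>R h"] function_space_scaleR[OF fs, of "-1" h] eq
    by eventually_elim simp
  then have "g + (-1) *\<^sub>R h = 0"
    using fs unfolding function_space_def by blast
  then show ?thesis by simp
qed

text \<open>
  Multiplication by a fixed function is linear, which allows products to be checked on spanning sets
  only; used once in each factor.
\<close>
lemma subspace_multipliers: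
  assumes fs: "function_space M rep" and V: "subspace V"
  shows "subspace {q. \<exists>h\<in>V. AE x in M. rep h x = rep q x * k x}"
proof (rule subspaceI; clarify?)
  show "\<exists>h\<in>V. AE x in M. rep h x = rep 0 x * k x"
    using function_space_zero[OF fs] by (intro bexI[of _ 0] subspace_0 V) auto
next
  fix q1 q2 h1 h2
  assume h: "h1 \<in> V" "h2 \<in> V"
    "AE x in M. rep h1 x = rep q1 x * k x" "AE x in M. rep h2 x = rep q2 x * k x"
  have "AE x in M. rep (h1 + h2) x = rep (q1 + q2) x * k x"
    using h(3,4) function_space_add[OF fs, of h1 h2] function_space_add[OF fs, of q1 q2]
    by eventually_elim (simp add: distrib_right)
  then show "\<exists>h\<in>V. AE x in M. rep h x = rep (q1 + q2) x * k x"
    using subspace_add[OF V h(1,2)] by blast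
next
  fix a q h
  assume h: "h \<in> V" "AE x in M. rep h x = rep q x * k x"
  have "AE x in M. rep (a *\<^sub>R h) x = rep (a *\<^sub>R q) x * k x"
    using h(2) function_space_scaleR[OF fs, of a h] function_space_scaleR[OF fs, of a q]
    by eventually_elim simp
  then show "\<exists>h\<in>V. AE x in M. rep h x = rep (a *\<^sub>R q) x * k x"
    using subspace_scale[OF V h(1)] by blast
qed

text \<open>The homogeneous part of \<^const>\<open>products\<close>: an induction on powers has to know that there
  is room for one more factor before the bound \<open>p\<close> is reached.\<close>
definition products_of_degree ::
  "'x measure \<Rightarrow> ('h \<Rightarrow> 'x \<Rightarrow> real) \<Rightarrow> nat \<Rightarrow> 'h set \<Rightarrow> 'h set" where
  "products_of_degree M rep i B = {h. \<exists>b. (\<forall>j\<in>{1..i}. b j \<in> B) \<and> is_product M rep i b h}"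

lemma products_of_degree_subset:
  assumes "i \<in> {1..p}"
  shows "products_of_degree M rep i B \<subseteq> products M rep p B"
  unfolding products_of_degree_def products_def using assms by blast

text \<open>
  The product is bilinear, so it suffices to multiply a product of \<open>i\<close> factors from \<open>B\<close> by one more
  factor from \<open>B\<close>; the bound on the degree ensures that the result belongs to the function space.
\<close>
lemma span_products_times_span:
  assumes fs: "function_space M rep" and prods: "products_in_space M rep p B" and i: "Suc i \<le> p"
    and q: "q \<in> span (products_of_degree M rep i B)" and v: "v \<in> span B"
  shows "\<exists>h\<in>span (products_of_degree M rep (Suc i) B). AE x in M. rep h x = rep q x * rep v x"
  using q
proof (rule span_induct[where P = "\<lambda>q. \<exists>h\<in>span (products_of_degree M rep (Suc i) B). AE x in M. rep h x = rep q x * rep v x"])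
  show "subspace {q. \<exists>h\<in>span (products_of_degree M rep (Suc i) B). AE x in M. rep h x = rep q x * rep v x}"
    by (rule subspace_multipliers[OF fs subspace_span])
next
  fix q assume "q \<in> products_of_degree M rep i B"
  then obtain b where b: "\<And>j. j \<in> {1..i} \<Longrightarrow> b j \<in> B" "AE x in M. rep q x = (\<Prod>j=1..i. rep (b j) x)"
    unfolding products_of_degree_def is_product_def by blast
  have "\<exists>h\<in>span (products_of_degree M rep (Suc i) B). AE x in M. rep h x = rep v x * rep q x"
    using v
  proof (rule span_induct[where P = "\<lambda>v. \<exists>h\<in>span (products_of_degree M rep (Suc i) B). AE x in M. rep h x = rep v x * rep q x"])
    show "subspace {v. \<exists>h\<in>span (products_of_degree M rep (Suc i) B). AE x in M. rep h x = rep v x * rep q x}"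
      by (rule subspace_multipliers[OF fs subspace_span])
  next
    fix v assume v: "v \<in> B"
    let ?b = "b(Suc i := v)"
    have B: "\<forall>j\<in>{1..Suc i}. ?b j \<in> B" using b(1) v by auto
    then obtain h where h: "is_product M rep (Suc i) ?b h"
      using prods i unfolding products_in_space_def by (metis Suc_le_eq atLeastAtMost_iff le_add1 plus_1_eq_Suc)
    have "AE x in M. rep h x = rep v x * rep q x"
      using h[unfolded is_product_def] b(2)
    proof eventually_elim
      case (elim x)
      have "(\<Prod>j=1..i. rep (?b j) x) = (\<Prod>j=1..i. rep (b j) x)" by (rule prod.cong) auto
      then show ?case using elim by (simp add: mult.commute)
    qed
    then show "\<exists>h\<in>span (products_of_degree M rep (Suc i) B). AE x in M. rep h x = rep v x * rep q x"
      using B h unfolding products_of_degree_def by (intro bexI[of _ h] span_base) blast+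
  qed
  then show "\<exists>h\<in>span (products_of_degree M rep (Suc i) B). AE x in M. rep h x = rep q x * rep v x"
    by (simp add: mult.commute)
qed

lemma power_in_span_products:
  assumes fs: "function_space M rep" and prods: "products_in_space M rep p B"
    and v: "v \<in> span B" and i: "1 \<le> i" "i \<le> p"
  shows "\<exists>h\<in>span (products_of_degree M rep i B). AE x in M. rep h x = rep v x ^ i"
  using i
proof (induction i rule: nat_induct_at_least)
  case base
  have "B \<subseteq> products_of_degree M rep 1 B"
    by (auto simp: products_of_degree_def is_product_def)
  then have "v \<in> span (products_of_degree M rep 1 B)"
    using v span_mono by blast
  then show ?case by (intro bexI[of _ v]) auto
next
  case (Suc i)
  then obtain q where q: "q \<in> span (products_of_degree M rep i B)" "AE x in M. rep q x = rep v x ^ i"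
    by auto
  obtain h where h: "h \<in> span (products_of_degree M rep (Suc i) B)" 
      "AE x in M. rep h x = rep q x * rep v x"
    using span_products_times_span[OF fs prods Suc.prems q(1) v] by blast
  have "AE x in M. rep h x = rep v x ^ Suc i"
    using h(2) q(2) by eventually_elim simp
  then show ?case using h(1) by blast
qed

text \<open>
  The polynomial is expanded into monomials: the powers of \<open>j w\<close> with exponent between \<open>1\<close> and the
  degree are combinations of products, and the constant term is covered by hypothesis.  An element of
  the function space is determined by its values almost everywhere, so the expansion is an identity
  of vectors.
\<close>
lemma superposition_in_span_products:
  assumes fs: "function_space M rep" and N: "superposition_operator M rep j P N"
    and prods: "products_in_space M rep (degree P) B"
    and const: "\<exists>h\<in>span (products M rep (degree P) B). AE x in M. rep h x = coeff P 0"
    and w: "blinfun_apply j w \<in> span B"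
  shows "N w \<in> span (products M rep (degree P) B)"
proof -
  let ?V = "span (products M rep (degree P) B)"
  have "\<exists>h\<in>?V. AE x in M. rep h x = coeff P k * rep (j w) x ^ k" if k: "k \<in> {..degree P}" for k
  proof (cases "k = 0")
    case True
    then show ?thesis using const by simp
  next
    case False
    then have k': "k \<in> {1..degree P}" using k by auto
    then obtain h where h: "h \<in> span (products_of_degree M rep k B)" "AE x in M. rep h x = rep (j w) x ^ k"
      using power_in_span_products[OF fs prods w, of k] by auto
    have "coeff P k *\<^sub>R h \<in> ?V"
      using h(1) span_mono[OF products_of_degree_subset[OF k']] by (intro span_mul) blast
    moreover have "AE x in M. rep (coeff P k *\<^sub>R h) x = coeff P k * rep (j w) x ^ k"
      using h(2) function_space_scaleR[OF fs, of "coeff P k" h] by eventually_elim simp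
    ultimately show ?thesis by blast
  qed
  then obtain h where h: "\<And>k. k \<in> {..degree P} \<Longrightarrow> h k \<in> ?V"
      "\<And>k. k \<in> {..degree P} \<Longrightarrow> AE x in M. rep (h k) x = coeff P k * rep (j w) x ^ k"
    by metis
  have "AE x in M. \<forall>k\<in>{..degree P}. rep (h k) x = coeff P k * rep (j w) x ^ k"
    using h(2) by (subst AE_ball_countable) auto
  moreover have "AE x in M. rep (N w) x = poly P (rep (j w) x)"
    using N by (simp add: superposition_operator_def)
  ultimately have "AE x in M. rep (N w) x = rep (\<Sum>k\<le>degree P. h k) x"
    using function_space_sum[OF fs finite_atMost, of h "degree P"]
    by eventually_elim (simp add: poly_altdef)
  then have "N w = (\<Sum>k\<le>degree P. h k)" by (rule function_space_eqI[OF fs])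
  moreover have "(\<Sum>k\<le>degree P. h k) \<in> ?V" using h(1) by (intro span_sum)
  ultimately show ?thesis by simp
qed

section \<open>Orthonormal expansions and the second Newton step\<close>

lemma bounded_linear_proj_onto: "bounded_linear (proj_onto n e)"
  unfolding proj_onto_def
  by (intro bounded_linear_sum bounded_linear_scaleR_const bounded_linear_inner_right)

lemma proj_onto_in_span: "proj_onto n e w \<in> span (e ` {1..n})"
  unfolding proj_onto_def by (intro span_sum span_mul span_base) auto

lemma proj_onto_span:
  assumes e: "orthonormal_family n e" and h: "h \<in> span (e ` {1..n})"
  shows "proj_onto n e h = h"
  using h
proof (rule span_induct[where P = "\<lambda>h. proj_onto n e h = h"])
  interpret linear "proj_onto n e" by (rule bounded_linear.linear[OF bounded_linear_proj_onto])
  show "subspace {h. proj_onto n e h = h}"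
    by (rule subspaceI) (auto simp: add scale zero)
next
  fix h assume "h \<in> e ` {1..n}"
  then obtain k where k: "k \<in> {1..n}" "h = e k" by blast
  have "proj_onto n e h = (\<Sum>i=1..n. if i = k then e i else 0)"
    unfolding proj_onto_def k(2)
    using e k(1) by (intro sum.cong) (auto simp: orthonormal_family_def)
  then show "proj_onto n e h = h" using k by simp
qed

theorem theorem3p13:
  fixes T :: real
    and M :: "'x measure"
    and rep :: "'h::{real_inner, complete_space} \<Rightarrow> 'x \<Rightarrow> real"
    and jVW :: "'v::{real_inner, complete_space} \<Rightarrow>\<^sub>L 'w::{real_inner, complete_space}"
    and jWH :: "'w \<Rightarrow>\<^sub>L 'h"
    and yV :: "'y::banach \<Rightarrow> real \<Rightarrow> 'v"
    and yH :: "'y \<Rightarrow> real \<Rightarrow> 'h"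
    and zH :: "'z::banach \<Rightarrow> real \<Rightarrow> 'h"
    and zW :: "'z \<Rightarrow>\<^sub>L 'w"
    and uR :: "'u::{real_inner, complete_space} \<Rightarrow> real \<Rightarrow> real"
    and D :: "'v set"
    and A :: "'v \<Rightarrow> 'h"
    and N :: "'w \<Rightarrow> 'h"
    and N' :: "'w \<Rightarrow> 'w \<Rightarrow>\<^sub>L 'h"
    and F :: 'h
    and y0 :: 'w
    and E :: "'y \<times> 'u \<Rightarrow> 'z"
    and P :: "real poly"
    and p n m :: nat
    and ybar :: 'y
    and ybar0 :: 'v
    and S :: "real \<Rightarrow> 'h \<Rightarrow>\<^sub>L 'h"
    and C :: "'w \<Rightarrow>\<^sub>L 'h"
    and u :: 'u
    and d1 :: 'y
    and d2 :: "real \<Rightarrow> 'h"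
    and \<psi> :: "nat \<Rightarrow> 'w"
    and CC :: "'h set"
    and c :: "nat \<Rightarrow> 'h"
    and \<beta> \<gamma> :: "nat \<Rightarrow> real \<Rightarrow> 'w"
  assumes T: "T > 0"
    and V_W: "dense_embedding jVW"
    and W_H: "dense_embedding jWH"
    and H_functions: "function_space M rep"
    and Y: "state_space T (jWH o\<^sub>L jVW) yV yH"
    and Z: "data_space T zH zW"
    and U: "is_L2_space T uR"
    and A: "linear_operator D A"
    and N_cont: "continuous_on UNIV N"
    and N_poly: "superposition_operator M rep jWH P N"
    and degree_P: "degree P = p"
    and N': "\<And>w. (N has_derivative blinfun_apply (N' w)) (at w)"
    and E: "state_operator T jVW jWH yV yH uR zH zW D A N F y0 E"
    and E_C1: "C1_with_invertible_partial E"
    and generation: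
      "\<And>y v. \<forall>t\<in>{0..T}. yH y t = jWH (jVW v) \<Longrightarrow>
         \<exists>S. generates (jWH o\<^sub>L jVW) D (\<lambda>w. A w - N' (jVW v) (jVW w)) S"
    and ybar: "\<forall>t\<in>{0..T}. yH ybar t = jWH (jVW ybar0)"
    and C: "C = - N' (jVW ybar0)"
    and S: "generates (jWH o\<^sub>L jVW) D (\<lambda>w. A w + C (jVW w)) S"
    and d1: "mild_solution T S
               (\<lambda>t. A ybar0 - N (jVW ybar0) + uR u t *\<^sub>R F) (jWH (y0 - jVW ybar0)) (yH d1)"
    and \<psi>: "orthonormal_family n \<psi>"
    and products_in_H:
      "products_in_space M rep p (insert (jWH (jVW ybar0)) ((\<lambda>i. jWH (\<psi> i)) ` {1..n}))"
    and CC: "CC = span (products M rep p (insert (jWH (jVW ybar0)) ((\<lambda>i. jWH (\<psi> i)) ` {1..n})))"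
    and constant_term: "\<exists>h\<in>CC. AE x in M. rep h x = coeff P 0"
    and c: "orthonormal_family m c"
    and CC_c: "CC = span (c ` {1..m})"
    and \<beta>: "\<And>i. i \<in> {1..n} \<Longrightarrow> \<beta> i \<in> Lq 2 T \<and>
           (\<exists>z. mild_solution T S (\<lambda>t. 0) (- C (\<psi> i)) z \<and>
                (AE t in lebesgue_on {0..T}. jWH (\<beta> i t) = z t))"
    and \<gamma>: "\<And>j. j \<in> {1..m} \<Longrightarrow> \<gamma> j \<in> Lq 2 T \<and>
           (\<exists>z. mild_solution T S (\<lambda>t. 0) (- c j) z \<and>
                (AE t in lebesgue_on {0..T}. jWH (\<gamma> j t) = z t))"
    and d2: "mild_solution T S
               (\<lambda>t. N (jVW ybar0) - C (proj_onto n \<psi> (jVW (yV d1 t)))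
                    - N (jVW ybar0 + proj_onto n \<psi> (jVW (yV d1 t)))) 0 d2"
  shows "\<exists>r :: real \<Rightarrow> 'h. \<exists>b c' :: real \<Rightarrow> 'w. \<forall>t\<in>{0..T}.
           d2 t = r t + jWH (b t) + jWH (c' t) \<and>
           r t = integral {0..t} (\<lambda>s. S (t - s) (N (jVW ybar0))) \<and>
           b t \<in> closure (span (\<Union>i\<in>{1..n}. essential_range T (\<beta> i))) \<and>
           c' t \<in> closure (span (\<Union>j\<in>{1..m}. essential_range T (\<gamma> j)))"
proof -
  let ?I = "{0..T}"
  let ?B = "insert (jWH (jVW ybar0)) ((\<lambda>i. jWH (\<psi> i)) ` {1..n})"
  let ?Kb = "closure (span (\<Union>i\<in>{1..n}. essential_range T (\<beta> i)))"
  let ?Kc = "closure (span (\<Union>j\<in>{1..m}. essential_range T (\<gamma> j)))"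
  define prj where "prj s = proj_onto n \<psi> (jVW (yV d1 s))" for s
  define N0 where "N0 = N (jVW ybar0)"
  define N1 where "N1 s = N (jVW ybar0 + prj s)" for s
  define f where "f s = N0 - C (prj s) - N1 s" for s
  define a where "a i s = \<psi> i \<bullet> jVW (yV d1 s)" for i s
  define g where "g j s = c j \<bullet> N1 s" for j s

  \<comment> \<open>Both nonlinear terms of the right-hand side are values of \<open>N\<close> at points of \<open>span ?B\<close>, hence
    combinations of the \<open>c j\<close>.\<close>
  have N_in_CC: "N w \<in> CC" if "jWH w \<in> span ?B" for w
    using superposition_in_span_products[OF H_functions N_poly, of ?B w] products_in_H constant_term that
    unfolding CC degree_P by blast
  have expand: "h = (\<Sum>j=1..m. (c j \<bullet> h) *\<^sub>R c j)" if "h \<in> CC" for h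
    using proj_onto_span[OF c, of h] that CC_c by (simp add: proj_onto_def)
  have N0: "N0 = (\<Sum>j=1..m. (c j \<bullet> N0) *\<^sub>R c j)"
    unfolding N0_def by (intro expand N_in_CC span_base) simp
  have "jWH (jVW ybar0 + prj s) \<in> span ?B" for s
  proof -
    have "jWH (prj s) = (\<Sum>i=1..n. a i s *\<^sub>R jWH (\<psi> i))"
      by (simp add: prj_def proj_onto_def a_def blinfun.sum_right blinfun.scaleR_right)
    moreover have "(\<Sum>i=1..n. a i s *\<^sub>R jWH (\<psi> i)) \<in> span ?B"
      by (intro span_sum span_mul span_base) auto
    ultimately show ?thesis
      by (simp add: blinfun.add_right span_add span_base)
  qed
  then have N1: "N1 s = (\<Sum>j=1..m. g j s *\<^sub>R c j)" for s
    unfolding g_def N1_def by (intro expand N_in_CC)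
  have C_prj: "C (prj s) = (\<Sum>i=1..n. a i s *\<^sub>R C (\<psi> i))" for s
    by (simp add: prj_def proj_onto_def a_def blinfun.sum_right blinfun.scaleR_right)

  have yV: "yV d1 \<in> Lq 2 T"
    using Y by (simp add: state_space_def bounded_linear_L2_def)
  have f: "f \<in> Lq 2 T" and d2_eq: "\<And>t. t \<in> ?I \<Longrightarrow> d2 t = integral {0..t} (\<lambda>s. S (t - s) (f s))"
    using d2 by (auto simp: mild_solution_def f_def[abs_def] N0_def N1_def prj_def)
  have a: "a i \<in> Lq 2 T" for i
    unfolding a_def
    by (intro Lq_bounded_linear[OF yV, of "\<lambda>v. \<psi> i \<bullet> jVW v"] bounded_linear_inner_right_comp
        blinfun.bounded_linear_right)
  have "bounded_linear (\<lambda>v. C (proj_onto n \<psi> (jVW v)))"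
    by (intro bounded_linear_compose[OF blinfun.bounded_linear_right]
        bounded_linear_compose[OF bounded_linear_proj_onto] blinfun.bounded_linear_right)
  then have "(\<lambda>s. C (prj s)) \<in> Lq 2 T"
    unfolding prj_def by (rule Lq_bounded_linear[OF yV])
  \<comment> \<open>Square integrability of \<open>N1\<close> is read off from that of the full right-hand side \<open>f\<close>, which is
    part of the notion of mild solution.\<close>
  then have "(\<lambda>s. N0 - C (prj s) - f s) \<in> Lq 2 T"
    by (intro Lq2_diff Lq_const f)
  then have "N1 \<in> Lq 2 T"
    by (simp add: f_def)
  then have g: "g j \<in> Lq 2 T" for j
    unfolding g_def by (rule Lq_bounded_linear) (rule bounded_linear_inner_right)

  have "\<exists>b\<in>?Kb. \<exists>c'\<in>?Kc. d2 t = integral {0..t} (\<lambda>s. S (t - s) N0) + jWH b + jWH c'"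
    if t: "t \<in> ?I" for t
  proof -
    have tT: "t \<le> T" using t by simp
    obtain b where b: "b \<in> ?Kb"
        "((\<lambda>s. - S (t - s) (\<Sum>i=1..n. a i s *\<^sub>R C (\<psi> i))) has_integral jWH b) {0..t}"
      using sum_of_convolutions[where n=n and \<phi>=\<beta> and a=a and x="\<lambda>i. C (\<psi> i)", OF \<beta> a tT] by blast
    obtain c' where c': "c' \<in> ?Kc"
        "((\<lambda>s. - S (t - s) (\<Sum>j=1..m. g j s *\<^sub>R c j)) has_integral jWH c') {0..t}"
      using sum_of_convolutions[where n=m and \<phi>=\<gamma> and a=g and x=c, OF \<gamma> g tT] by blast
    \<comment> \<open>\<open>N0\<close> is a combination of the \<open>c j\<close> with constant coefficients, so its orbit is integrable
      by the same convolution argument; this is what allows the integral to be split.\<close>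
    obtain r where "((\<lambda>s. - S (t - s) (\<Sum>j=1..m. (c j \<bullet> N0) *\<^sub>R c j)) has_integral jWH r) {0..t}"
      using sum_of_convolutions[where n=m and \<phi>=\<gamma> and a="\<lambda>j _. c j \<bullet> N0" and x=c, OF \<gamma> Lq_const tT] by blast
    from has_integral_neg[OF this[folded N0]]
    have r: "((\<lambda>s. S (t - s) N0) has_integral - jWH r) {0..t}"
      by (simp only: minus_minus)
    have "((\<lambda>s. S (t - s) (f s)) has_integral (- jWH r + jWH b + jWH c')) {0..t}"
      using has_integral_add[OF has_integral_add[OF r b(2)] c'(2)]
      unfolding f_def C_prj[symmetric] N1[symmetric] by (simp add: blinfun.diff_right)
    then have "d2 t = - jWH r + jWH b + jWH c'"
      using d2_eq[OF t] by (simp add: integral_unique)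
    then show ?thesis
      using r b(1) c'(1) by (auto simp: integral_unique)
  qed
  then have "\<forall>t\<in>?I. \<exists>bc. fst bc \<in> ?Kb \<and> snd bc \<in> ?Kc \<and>
      d2 t = integral {0..t} (\<lambda>s. S (t - s) N0) + jWH (fst bc) + jWH (snd bc)"
    by fastforce
  from bchoice[OF this] obtain bc where "\<forall>t\<in>?I. fst (bc t) \<in> ?Kb \<and> snd (bc t) \<in> ?Kc \<and>
      d2 t = integral {0..t} (\<lambda>s. S (t - s) N0) + jWH (fst (bc t)) + jWH (snd (bc t))"
    by blast
  then show ?thesis
    unfolding N0_def by (intro exI[of _ "\<lambda>t. integral {0..t} (\<lambda>s. S (t - s) (N (jVW ybar0)))"] 
      exI[of _ "\<lambda>t. fst (bc t)"] exI[of _ "\<lambda>t. snd (bc t)"]) simp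
qed

end
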